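(* For every $\alpha>0$ there exist $n_0$ and $\gamma>0$ depending only on $\alpha$ such that the following holds. Let $H$ be an $n$-vertex $3$-graph with $3\mid n$ and $n\ge n_0$, let $p = 6|H|/n^3$, and assume that every pair of distinct vertices lies in at least $\alpha p n$ edges of $H$ and that $\lambda_2(H)\le \gamma p^{16} n^{3/2}$. Then $H$ contains a perfect matching.
   Context: A $3$-graph $H$ is a set of $3$-element subsets (edges) of a vertex set $V(H)=[n]$; $|H|$ is its number of edges. Let $A_H$ be the adjacency tensor: $A_H(i,j,k)=1$ if $\{i,j,k\}\in H$ (in particular $i,j,k$ distinct) and $0$ otherwise, and let $J$ be the all-ones $n\times n\times n$ tensor. For a tensor $T$, let $\|T\| = \sup\{|\sum_{i,j,k} T(i,j,k)x_iy_jz_k| : x,y,z\in\mathbb{R}^n,\ \|x\|=\|y\|=\|z\|=1\}$. Then $\lambda_1(H)=\|A_H\|$ and $\lambda_2(H)=\|A_H - \frac{6|H|}{n^3}J\|$. A perfect matching is a set of pairwise disjoint edges covering $V(H)$.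
   Formalization: The formal theorem additionally assumes that H has at least one edge (p > 0); for H with no edges all hypotheses hold trivially (p = 0 and λ₂(H) = 0) but there is no perfect matching. *)

theory Defs
  imports "HOL-Analysis.Analysis"
begin

text \<open>The dimension \<open>n\<close> is quantified inside the theorem, after the choice of \<open>n\<^sub>0\<close>, so it
  cannot be a type.  Vectors and tensors are therefore functions on \<^typ>\<open>nat\<close> of which only the
  values at indices in \<open>{1..n}\<close> are used.\<close>

definition three_graph :: "nat \<Rightarrow> nat set set \<Rightarrow> bool" where
  "three_graph n H \<longleftrightarrow> (\<forall>e\<in>H. e \<subseteq> {1..n} \<and> card e = 3)"

text \<open>If two of the indices coincide then \<open>{i, j, k}\<close> has fewer than three elements, so it is not
  an edge of a 3-graph and the entry is \<open>0\<close>.\<close>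

definition adj_tensor :: "nat set set \<Rightarrow> nat \<Rightarrow> nat \<Rightarrow> nat \<Rightarrow> real" where
  "adj_tensor H i j k = (if {i, j, k} \<in> H then 1 else 0)"

definition ones_tensor :: "nat \<Rightarrow> nat \<Rightarrow> nat \<Rightarrow> real" where
  "ones_tensor i j k = 1"

definition tensor_form ::
    "nat \<Rightarrow> (nat \<Rightarrow> nat \<Rightarrow> nat \<Rightarrow> real) \<Rightarrow> (nat \<Rightarrow> real) \<Rightarrow> (nat \<Rightarrow> real) \<Rightarrow> (nat \<Rightarrow> real) \<Rightarrow> real" where
  "tensor_form n T x y z = (\<Sum>i\<in>{1..n}. \<Sum>j\<in>{1..n}. \<Sum>k\<in>{1..n}. T i j k * x i * y j * z k)"

definition tensor_norm :: "nat \<Rightarrow> (nat \<Rightarrow> nat \<Rightarrow> nat \<Rightarrow> real) \<Rightarrow> real" where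
  "tensor_norm n T = Sup {\<bar>tensor_form n T x y z\<bar> | x y z.
     L2_set x {1..n} = 1 \<and> L2_set y {1..n} = 1 \<and> L2_set z {1..n} = 1}"

text \<open>\<^const>\<open>Sup\<close> on the reals is meaningful only for nonempty sets that are bounded above.  The
  next two facts show that this is the case here whenever \<open>n \<ge> 1\<close>.\<close>

lemma tensor_norm_bdd_above:
  "bdd_above {\<bar>tensor_form n T x y z\<bar> | x y z.
     L2_set x {1..n} = 1 \<and> L2_set y {1..n} = 1 \<and> L2_set z {1..n} = 1}"
proof (rule bdd_aboveI, safe)
  fix x y z :: "nat \<Rightarrow> real"
  assume u: "L2_set x {1..n} = 1" "L2_set y {1..n} = 1" "L2_set z {1..n} = 1"
  have le1: "\<bar>w i\<bar> \<le> 1" if "L2_set w {1..n} = 1" "i \<in> {1..n}" for w :: "nat \<Rightarrow> real" and i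
    using member_le_L2_set[of "{1..n}" i "\<lambda>i. \<bar>w i\<bar>"] that by (simp add: L2_set_def)
  have "\<bar>T i j k * x i * y j * z k\<bar> \<le> \<bar>T i j k\<bar>"
    if "i \<in> {1..n}" "j \<in> {1..n}" "k \<in> {1..n}" for i j k
  proof -
    have "\<bar>x i\<bar> * \<bar>y j\<bar> * \<bar>z k\<bar> \<le> 1"
      using le1[OF u(1) that(1)] le1[OF u(2) that(2)] le1[OF u(3) that(3)]
      by (intro mult_le_one) auto
    then show ?thesis
      using mult_left_le[of "\<bar>x i\<bar> * \<bar>y j\<bar> * \<bar>z k\<bar>" "\<bar>T i j k\<bar>"]
      by (simp add: abs_mult mult.assoc)
  qed
  then show "\<bar>tensor_form n T x y z\<bar> \<le> (\<Sum>i\<in>{1..n}. \<Sum>j\<in>{1..n}. \<Sum>k\<in>{1..n}. \<bar>T i j k\<bar>)"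
    unfolding tensor_form_def by (intro order_trans[OF sum_abs] sum_mono) auto
qed

lemma tensor_norm_nonempty:
  assumes "n \<ge> 1"
  shows "{\<bar>tensor_form n T x y z\<bar> | x y z.
     L2_set x {1..n} = 1 \<and> L2_set y {1..n} = 1 \<and> L2_set z {1..n} = 1} \<noteq> {}"
proof -
  define x :: "nat \<Rightarrow> real" where "x = (\<lambda>i. if i = 1 then 1 else 0)"
  have "(\<Sum>i\<in>{1..n}. (x i)\<^sup>2) = (\<Sum>i\<in>{1..n}. if i = 1 then 1 else 0)"
    by (intro sum.cong) (auto simp: x_def)
  then have "L2_set x {1..n} = 1"
    using assms by (simp add: L2_set_def)
  then show ?thesis by blast
qed

definition edge_density :: "nat \<Rightarrow> nat set set \<Rightarrow> real" where
  "edge_density n H = 6 * real (card H) / real n ^ 3"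

definition lambda2 :: "nat \<Rightarrow> nat set set \<Rightarrow> real" where
  "lambda2 n H = tensor_norm n (\<lambda>i j k. adj_tensor H i j k - edge_density n H * ones_tensor i j k)"

definition pair_degree :: "nat set set \<Rightarrow> nat \<Rightarrow> nat \<Rightarrow> nat" where
  "pair_degree H u v = card {e \<in> H. {u, v} \<subseteq> e}"

definition has_perfect_matching :: "nat \<Rightarrow> nat set set \<Rightarrow> bool" where
  "has_perfect_matching n H \<longleftrightarrow> (\<exists>M \<subseteq> H. pairwise disjnt M \<and> \<Union>M = {1..n})"

end

theory Submission
  imports Defs "HOL-Real_Asymp.Real_Asymp"
begin

text \<open>
  Call a set of two vertices a pair, and say that a vertex completes a pair if together they form an
  edge. Fix about \<open>\<alpha> p n / 12\<close> disjoint pairs such that every vertex completes at least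
  \<open>\<alpha>\<^sup>2 p\<^sup>2 n / 384\<close> of them, and such that some matching contains each pair in one of its edges.
  The pairs are chosen greedily: weighting a vertex that completes \<open>k\<close> of the pairs
  chosen so far by \<open>2\<^sup>-\<^sup>k\<close>, the codegree condition provides a new pair that decreases the total
  weight by a factor \<open>1 - \<alpha> p / 8\<close>.

  Now take a largest matching \<open>M\<close> with each pair contained in one of its edges. If it is not perfect, it
  misses three vertices \<open>u\<^sub>1, u\<^sub>2, u\<^sub>3\<close>. Let \<open>W\<^sub>j\<close> consist of the third vertices of the edges of \<open>M\<close>
  that contain a pair completed by \<open>u\<^sub>j\<close>. The spectral bound yields an edge \<open>{w\<^sub>1, w\<^sub>2, w\<^sub>3}\<close> with
  \<open>w\<^sub>j \<in> W\<^sub>j\<close>. Exchanging \<open>w\<^sub>j\<close> for \<open>u\<^sub>j\<close> frees this edge, which can be added to the matching,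
  a contradiction.
\<close>

section \<open>Matchings that host a family of disjoint pairs, and the exchange of vertices\<close>

definition matching :: "'a set set \<Rightarrow> 'a set set \<Rightarrow> bool" where
  "matching H M \<longleftrightarrow> M \<subseteq> H \<and> pairwise disjnt M"

definition disjoint_pairs :: "'a set set \<Rightarrow> bool" where
  "disjoint_pairs P \<longleftrightarrow> (\<forall>Q\<in>P. card Q = 2) \<and> pairwise disjnt P"

definition hosts :: "'a set set \<Rightarrow> 'a set set \<Rightarrow> bool" where
  "hosts M P \<longleftrightarrow> (\<forall>Q\<in>P. \<exists>w. w \<notin> Q \<and> insert w Q \<in> M)"

definition completed :: "'a set set \<Rightarrow> 'a set set \<Rightarrow> 'a \<Rightarrow> 'a set set" where
  "completed H P u = {Q\<in>P. insert u Q \<in> H}"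

text \<open>These are the vertices that an uncovered \<open>u\<close> can free: trading
  \<open>insert w Q\<close> for \<open>insert u Q\<close> releases \<open>w\<close>.\<close>

definition third_vertices :: "'a set set \<Rightarrow> 'a set set \<Rightarrow> 'a set set \<Rightarrow> 'a \<Rightarrow> 'a set" where
  "third_vertices H M P u = {w. \<exists>Q\<in>completed H P u. w \<notin> Q \<and> insert w Q \<in> M}"

lemma disjoint_familyD:
  assumes "pairwise disjnt M" "e \<in> M" "f \<in> M" "x \<in> e" "x \<in> f"
  shows "e = f"
  using assms by (meson disjnt_iff pairwiseD)

text \<open>Any two pairs inside a triple meet, so a triple contains at most one member of a
  disjoint family. Hence the edge that hosts a pair determines both the pair and the third
  vertex.\<close>

lemma insert_pair_inject:
  assumes P: "disjoint_pairs P" "Q \<in> P" "Q' \<in> P"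
    and eq: "insert w Q = insert w' Q'" and w: "w \<notin> Q" "w' \<notin> Q'"
  shows "Q = Q' \<and> w = w'"
proof -
  obtain x y where Q: "Q = {x, y}" "x \<noteq> y"
    using P by (metis disjoint_pairs_def card_2_iff)
  have "x \<in> Q' \<or> y \<in> Q'"
    using arg_cong[OF eq, of "\<lambda>A. x \<in> A"] arg_cong[OF eq, of "\<lambda>A. y \<in> A"] Q by auto
  then have "Q = Q'"
    using disjoint_familyD[of P Q Q'] P Q by (auto simp: disjoint_pairs_def)
  then show ?thesis
    using eq w by blast
qed

text \<open>Choosing a third vertex for each completed pair is injective: a common third vertex
  would force the two matching edges, and hence the two pairs, to coincide.\<close>

lemma card_third_vertices:
  assumes M: "matching H M" and hosts: "hosts M P" and P: "disjoint_pairs P"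
    and fin: "finite (third_vertices H M P u)"
  shows "card (completed H P u) \<le> card (third_vertices H M P u)"
proof -
  obtain f where f: "f Q \<notin> Q \<and> insert (f Q) Q \<in> M" if "Q \<in> P" for Q
    using hosts unfolding hosts_def by metis
  have sub: "completed H P u \<subseteq> P"
    by (auto simp: completed_def)
  have "inj_on f (completed H P u)"
  proof (rule inj_onI)
    fix Q Q' assume QQ': "Q \<in> completed H P u" "Q' \<in> completed H P u" and "f Q = f Q'"
    then have "insert (f Q) Q = insert (f Q') Q'"
      using disjoint_familyD[of M] f sub M by (metis matching_def insertI1 subsetD)
    then show "Q = Q'"
      using insert_pair_inject[OF P] f sub QQ' by (metis subsetD)
  qed
  moreover have "f ` completed H P u \<subseteq> third_vertices H M P u"
    using f sub by (auto simp: third_vertices_def)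
  ultimately show ?thesis
    using fin by (metis card_inj_on_le)
qed

text \<open>The pair \<open>Q\<close> is hosted afterwards by \<open>insert u Q\<close>, and the
  other pairs keep their edges. Since \<open>hosts\<close> survives, exchanges can be iterated; the
  formula for the union tracks which vertices are covered.\<close>

lemma exchange:
  assumes M: "matching H M" "finite M" and hosts: "hosts M P"
    and w: "w \<notin> Q" "insert w Q \<in> M"
    and u: "insert u Q \<in> H" "u \<notin> \<Union>M" and Q: "Q \<noteq> {}"
    and P: "disjoint_pairs P" "Q \<in> P"
  defines "M' \<equiv> insert (insert u Q) (M - {insert w Q})"
  shows "matching H M'" "hosts M' P" "card M' = card M" "\<Union>M' = insert u (\<Union>M) - {w}"
proof -
  have uQ: "u \<notin> Q" "u \<noteq> w" and new: "insert u Q \<notin> M"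
    using w u by auto
  have disj: "disjnt (insert w Q) e" if "e \<in> M - {insert w Q}" for e
    using M w that unfolding matching_def pairwise_def by (metis DiffE singletonI)
  have disj': "disjnt (insert u Q) e" if "e \<in> M - {insert w Q}" for e
    using disj[OF that] u that by (auto simp: disjnt_iff)
  show "matching H M'"
    using M u disj' unfolding matching_def M'_def
    by (auto simp: pairwise_insert disjnt_sym intro: pairwise_subset)
  show "card M' = card M"
    using M w new unfolding M'_def by (simp add: card_Suc_Diff1 del: card_Diff_insert)
  show "\<Union>M' = insert u (\<Union>M) - {w}"
  proof -
    have "\<Union>M = insert w Q \<union> \<Union>(M - {insert w Q})"
      using w by auto
    moreover have "w \<notin> \<Union>(M - {insert w Q})"
      using disj by (auto simp: disjnt_iff)
    ultimately show ?thesis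
      using w uQ unfolding M'_def by auto
  qed
  show "hosts M' P"
    unfolding hosts_def
  proof
    fix Q' assume Q': "Q' \<in> P"
    show "\<exists>v. v \<notin> Q' \<and> insert v Q' \<in> M'"
    proof (cases "Q' = Q")
      case True
      then show ?thesis using uQ by (auto simp: M'_def)
    next
      case False
      obtain v where v: "v \<notin> Q'" "insert v Q' \<in> M"
        using hosts Q' by (auto simp: hosts_def)
      moreover have "insert v Q' \<noteq> insert w Q"
        using insert_pair_inject[OF P(1) Q' P(2)] v w False by blast
      ultimately show ?thesis by (auto simp: M'_def)
    qed
  qed
qed

text \<open>Three successive exchanges free \<open>w1\<close>, \<open>w2\<close>, \<open>w3\<close>
  at no cost in size, and then their edge is added.\<close>

lemma augment:
  assumes M: "matching H M" "finite M" and hosts: "hosts M P" and P: "disjoint_pairs P"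
    and u: "u1 \<notin> \<Union>M" "u2 \<notin> \<Union>M" "u3 \<notin> \<Union>M" "distinct [u1, u2, u3]"
    and w: "w1 \<in> third_vertices H M P u1" "w2 \<in> third_vertices H M P u2"
      "w3 \<in> third_vertices H M P u3" "distinct [w1, w2, w3]"
    and edge: "{w1, w2, w3} \<in> H"
  shows "\<exists>M'. matching H M' \<and> hosts M' P \<and> card M' > card M"
proof -
  obtain Q1 where Q1: "Q1 \<in> P" "insert u1 Q1 \<in> H" "w1 \<notin> Q1" "insert w1 Q1 \<in> M"
    using w(1) by (auto simp: third_vertices_def completed_def)
  obtain Q2 where Q2: "Q2 \<in> P" "insert u2 Q2 \<in> H" "w2 \<notin> Q2" "insert w2 Q2 \<in> M"
    using w(2) by (auto simp: third_vertices_def completed_def)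
  obtain Q3 where Q3: "Q3 \<in> P" "insert u3 Q3 \<in> H" "w3 \<notin> Q3" "insert w3 Q3 \<in> M"
    using w(3) by (auto simp: third_vertices_def completed_def)
  have ne: "Q \<noteq> {}" if "Q \<in> P" for Q
    using P that by (auto simp: disjoint_pairs_def)
  \<comment> \<open>The three exchanges use different edges of \<open>M\<close>, so each edge is
    still present when its turn comes.\<close>
  have diff: "insert w1 Q1 \<noteq> insert w2 Q2" "insert w1 Q1 \<noteq> insert w3 Q3"
      "insert w2 Q2 \<noteq> insert w3 Q3"
    using insert_pair_inject[OF P] Q1 Q2 Q3 w(4) by (metis distinct_length_2_or_more)+
  define M1 where "M1 = insert (insert u1 Q1) (M - {insert w1 Q1})"
  note M1 = exchange[OF M hosts Q1(3,4,2) u(1) ne[OF Q1(1)] P Q1(1), folded M1_def]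
  have wM: "w1 \<in> \<Union>M" "w2 \<in> \<Union>M" "w3 \<in> \<Union>M"
    using Q1 Q2 Q3 by blast+
  have fin1: "finite M1"
    using M by (simp add: M1_def)
  have 2: "insert w2 Q2 \<in> M1" "u2 \<notin> \<Union>M1"
    using Q2 diff M1(4) u by (auto simp: M1_def)
  define M2 where "M2 = insert (insert u2 Q2) (M1 - {insert w2 Q2})"
  note M2 = exchange[OF M1(1) fin1 M1(2) Q2(3) 2(1) Q2(2) 2(2) ne[OF Q2(1)] P Q2(1), folded M2_def]
  have fin2: "finite M2"
    using fin1 by (simp add: M2_def)
  have 3: "insert w3 Q3 \<in> M2" "u3 \<notin> \<Union>M2"
    using Q3 diff M1(4) M2(4) u by (auto simp: M1_def M2_def)
  define M3 where "M3 = insert (insert u3 Q3) (M2 - {insert w3 Q3})"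
  note M3 = exchange[OF M2(1) fin2 M2(2) Q3(3) 3(1) Q3(2) 3(2) ne[OF Q3(1)] P Q3(1), folded M3_def]
  have free: "w1 \<notin> \<Union>M3" "w2 \<notin> \<Union>M3" "w3 \<notin> \<Union>M3"
    using M3(4) M2(4) M1(4) u wM by auto
  have "matching H (insert {w1, w2, w3} M3)"
    using M3(1) edge free unfolding matching_def
    by (auto simp: pairwise_insert disjnt_iff)
  moreover have "hosts (insert {w1, w2, w3} M3) P"
    using M3(2) unfolding hosts_def by blast
  moreover have "card (insert {w1, w2, w3} M3) > card M"
  proof -
    have "finite M3" "{w1, w2, w3} \<notin> M3"
      using fin2 free by (auto simp: M3_def)
    then show ?thesis using M1(3) M2(3) M3(3) by simp
  qed
  ultimately show ?thesis by blast
qed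

section \<open>From completed pairs to a perfect matching\<close>

locale three_uniform =
  fixes V :: "'a set" and H :: "'a set set"
  assumes finite_V: "finite V"
    and edge_subset: "e \<in> H \<Longrightarrow> e \<subseteq> V"
    and edge_card: "e \<in> H \<Longrightarrow> card e = 3"
begin

lemma edge_distinct:
  assumes "{x, y, z} \<in> H"
  shows "x \<in> V" "y \<in> V" "z \<in> V" "distinct [x, y, z]"
proof -
  show "x \<in> V" "y \<in> V" "z \<in> V"
    using edge_subset[OF assms] by simp_all
  show "distinct [x, y, z]"
    using edge_card[OF assms] by (simp add: card_insert_if split: if_splits)
qed

lemma finite_H: "finite H"
  using finite_V edge_subset by (intro finite_subset[of H "Pow V"]) auto

lemma finite_matching: "matching H M \<Longrightarrow> finite M"
  using finite_H finite_subset by (auto simp: matching_def)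

lemma Union_matching: "matching H M \<Longrightarrow> \<Union>M \<subseteq> V"
  using edge_subset by (auto simp: matching_def)

lemma card_Union_matching:
  assumes "matching H M"
  shows "card (\<Union>M) = 3 * card M"
proof -
  have "card (\<Union>M) = sum card M"
    using assms edge_subset finite_V
    by (intro card_Union_disjoint) (auto simp: matching_def intro: finite_subset)
  also have "\<dots> = (\<Sum>e\<in>M. 3)"
    using assms edge_card by (intro sum.cong) (auto simp: matching_def)
  finally show ?thesis by simp
qed

text \<open>Extremal argument among the matchings that host \<open>P\<close>. The number
  \<open>d\<close> links the two inputs: every vertex yields a set of at least \<open>d\<close>
  third vertices, and any three sets of that size are joined by an edge.\<close>

lemma perfect_matching_of_pairs:
  assumes P: "disjoint_pairs P" and ex: "matching H M0" "hosts M0 P"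
    and many: "\<And>u. u \<in> V \<Longrightarrow> d \<le> card (completed H P u)"
    and mix: "\<And>X Y Z. X \<subseteq> V \<Longrightarrow> Y \<subseteq> V \<Longrightarrow> Z \<subseteq> V \<Longrightarrow> d \<le> card X \<Longrightarrow> d \<le> card Y \<Longrightarrow> d \<le> card Z \<Longrightarrow>
      \<exists>x\<in>X. \<exists>y\<in>Y. \<exists>z\<in>Z. {x, y, z} \<in> H"
    and dvd: "3 dvd card V"
  shows "\<exists>M. matching H M \<and> \<Union>M = V"
proof -
  define S where "S = {M. matching H M \<and> hosts M P}"
  have "finite S"
    using finite_H by (rule_tac finite_subset[of _ "Pow H"]) (auto simp: S_def matching_def)
  moreover have "S \<noteq> {}"
    using ex by (auto simp: S_def)
  ultimately have "Max (card ` S) \<in> card ` S" and "\<And>M'. M' \<in> S \<Longrightarrow> card M' \<le> Max (card ` S)"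
    by auto
  then obtain M where MS: "M \<in> S" and max: "\<And>M'. M' \<in> S \<Longrightarrow> card M' \<le> card M"
    by auto
  have M: "matching H M" "hosts M P"
    using MS by (auto simp: S_def)
  have "\<Union>M = V"
  proof (rule ccontr)
    assume "\<Union>M \<noteq> V"
    then have "V - \<Union>M \<noteq> {}"
      using Union_matching[OF M(1)] by blast
    then have "card (V - \<Union>M) > 0"
      using finite_V by (simp add: card_gt_0_iff)
    moreover have "card (V - \<Union>M) = card V - 3 * card M"
      using card_Diff_subset[OF _ Union_matching[OF M(1)]] Union_matching[OF M(1)] finite_V
        card_Union_matching[OF M(1)] by (metis finite_subset)
    \<comment> \<open>The number of uncovered vertices is positive and divisible by 3.\<close>
    ultimately have "3 \<le> card (V - \<Union>M)"
      using dvd by (metis dvd_diff_nat dvd_imp_le dvd_triv_left)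
    then obtain T where T: "T \<subseteq> V - \<Union>M" "card T = 3"
      by (meson obtain_subset_with_card_n)
    then obtain u1 u2 u3 where u: "T = {u1, u2, u3}" "u1 \<noteq> u2" "u1 \<noteq> u3" "u2 \<noteq> u3"
      by (metis card_3_iff)
    define W where "W = third_vertices H M P"
    have WV: "W u \<subseteq> V" for u
      using edge_subset M(1) by (auto simp: W_def third_vertices_def matching_def)
    have "d \<le> card (W u)" if "u \<in> V" for u
      using card_third_vertices[OF M P] many[OF that] WV[of u] finite_V
      by (metis W_def finite_subset le_trans)
    \<comment> \<open>The three sets may overlap; distinctness of the \<open>w\<close>'s comes from
      their forming an edge.\<close>
    then obtain w1 w2 w3 where w: "w1 \<in> W u1" "w2 \<in> W u2" "w3 \<in> W u3" "{w1, w2, w3} \<in> H"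
      using mix[OF WV WV WV, of u1 u2 u3] T u by auto
    obtain M' where "matching H M'" "hosts M' P" "card M' > card M"
      using augment[OF M(1) finite_matching[OF M(1)] M(2) P, of u1 u2 u3 w1 w2 w3]
        T u w edge_distinct(4)[OF w(4)] by (auto simp: W_def)
    then show False
      using max[of M'] by (auto simp: S_def)
  qed
  then show ?thesis using M by blast
qed

section \<open>Greedy choice of the pairs\<close>

text \<open>Double counting with weights. For each \<open>u\<close> there are at least
  \<open>n / 2\<close> choices of \<open>a\<close> outside \<open>R\<close>, and each leaves at
  least \<open>\<beta> * n / 2\<close> choices of \<open>b\<close> outside \<open>R\<close>.
  Averaging over the at most \<open>n\<^sup>2\<close> ordered pairs gives the bound.\<close>

lemma heavy_pair:
  fixes weight :: "'a \<Rightarrow> real" and \<beta> :: real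
  assumes codeg: "\<And>u v. u \<in> V \<Longrightarrow> v \<in> V \<Longrightarrow> u \<noteq> v \<Longrightarrow> \<beta> * card V \<le> card {b. {u, v, b} \<in> H}"
    and \<beta>: "0 \<le> \<beta>" "\<beta> \<le> 1" and V: "4 \<le> card V"
    and R: "R \<subseteq> V" "4 * real (card R) \<le> \<beta> * card V"
    and weight: "\<And>u. u \<in> V \<Longrightarrow> 0 \<le> weight u"
  shows "\<exists>a\<in>V-R. \<exists>b\<in>V-R. \<beta> / 4 * sum weight V \<le> (\<Sum>u\<in>V. if {u, a, b} \<in> H then weight u else 0)"
proof (rule ccontr)
  assume "\<not> ?thesis"
  then have small: "(\<Sum>u\<in>V. if {u, a, b} \<in> H then weight u else 0) < \<beta> / 4 * sum weight V"
    if "a \<in> V - R" "b \<in> V - R" for a b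
    using that by (rule_tac ccontr, simp only: linorder_not_less, blast)
  let ?n = "real (card V)"
  let ?f = "\<lambda>u a b. if {u, a, b} \<in> H then weight u else 0"
  have cR: "real (card (V - R)) = ?n - card R"
    using R finite_V by (simp add: card_Diff_subset finite_subset card_mono of_nat_diff)
  have n4: "4 * real (card R) \<le> ?n"
    using R(2) \<beta>(2) mult_right_mono[of \<beta> 1 ?n] by simp
  have deg: "\<beta> * ?n\<^sup>2 / 4 * weight u \<le> (\<Sum>a\<in>V-R. \<Sum>b\<in>V-R. ?f u a b)" if u: "u \<in> V" for u
  proof -
    have inner: "\<beta> * ?n / 2 * weight u \<le> (\<Sum>b\<in>V-R. ?f u a b)" if a: "a \<in> V - R - {u}" for a
    proof -
      have sub: "{b. {u, a, b} \<in> H} \<subseteq> V"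
        using edge_distinct(3) by blast
      have "{b. {u, a, b} \<in> H} \<subseteq> {b\<in>V-R. {u, a, b} \<in> H} \<union> R"
        using sub by blast
      then have "card {b. {u, a, b} \<in> H} \<le> card ({b\<in>V-R. {u, a, b} \<in> H} \<union> R)"
        using finite_V R by (intro card_mono) (auto intro: finite_subset)
      also have "\<dots> \<le> card {b\<in>V-R. {u, a, b} \<in> H} + card R"
        by (rule card_Un_le)
      finally have "\<beta> * ?n \<le> card {b\<in>V-R. {u, a, b} \<in> H} + card R"
        using codeg[of u a] u a by fastforce
      then have "\<beta> * ?n / 2 \<le> card {b\<in>V-R. {u, a, b} \<in> H}"
        using R(2) \<beta> by simp
      then have "\<beta> * ?n / 2 * weight u \<le> card {b\<in>V-R. {u, a, b} \<in> H} * weight u"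
        using weight[OF u] by (intro mult_right_mono)
      also have "\<dots> = (\<Sum>b\<in>V-R. ?f u a b)"
        using finite_V by (simp add: sum.If_cases Int_def)
      finally show ?thesis .
    qed
    have "?n / 2 \<le> card (V - R - {u})"
    proof -
      have "card (V - R) \<le> card (V - R - {u}) + 1"
        using diff_card_le_card_Diff[of "{u}" "V - R"] by simp
      then show ?thesis using cR n4 V by linarith
    qed
    then have "?n / 2 * (\<beta> * ?n / 2 * weight u) \<le> card (V - R - {u}) * (\<beta> * ?n / 2 * weight u)"
      using \<beta> weight[OF u] by (intro mult_right_mono) auto
    also have "\<dots> \<le> (\<Sum>a\<in>V-R-{u}. \<Sum>b\<in>V-R. ?f u a b)"
      using inner by (intro sum_bounded_below) 
    also have "\<dots> \<le> (\<Sum>a\<in>V-R. \<Sum>b\<in>V-R. ?f u a b)"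
      using finite_V weight[OF u] by (intro sum_mono2) (auto intro: sum_nonneg)
    finally show ?thesis by (simp add: power2_eq_square mult.assoc mult.left_commute)
  qed
  have pos: "0 \<le> \<beta> / 4 * sum weight V"
    using \<beta> weight by (simp add: sum_nonneg)
  have "0 < real (card (V - R))"
    using cR n4 V by linarith
  then have ne: "V - R \<noteq> {}"
    by (metis card.empty less_irrefl of_nat_0)
  have "\<beta> * ?n\<^sup>2 / 4 * sum weight V \<le> (\<Sum>u\<in>V. \<Sum>a\<in>V-R. \<Sum>b\<in>V-R. ?f u a b)"
    unfolding sum_distrib_left by (intro sum_mono deg)
  also have "\<dots> = (\<Sum>a\<in>V-R. \<Sum>b\<in>V-R. \<Sum>u\<in>V. ?f u a b)"
    by (rule trans[OF sum.swap sum.cong[OF refl sum.swap]])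
  also have "\<dots> < (\<Sum>a\<in>V-R. \<Sum>b\<in>V-R. \<beta> / 4 * sum weight V)"
    using small ne finite_V by (intro sum_strict_mono) auto
  also have "\<dots> = (real (card (V - R)))\<^sup>2 * (\<beta> / 4 * sum weight V)"
    by (simp add: power2_eq_square)
  also have "\<dots> \<le> ?n\<^sup>2 * (\<beta> / 4 * sum weight V)"
    using pos finite_V by (intro mult_right_mono power_mono) (auto intro: card_mono)
  finally show False by simp
qed

text \<open>Here \<open>R\<close> is the set of vertices covered so far. The invariant that the
  matching covers all pairs makes a new pair outside \<open>R\<close> disjoint from the old
  ones.\<close>

lemma greedy_pairs:
  fixes \<beta> :: real
  assumes codeg: "\<And>u v. u \<in> V \<Longrightarrow> v \<in> V \<Longrightarrow> u \<noteq> v \<Longrightarrow> \<beta> * card V \<le> card {b. {u, v, b} \<in> H}"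
    and \<beta>: "0 < \<beta>" "\<beta> \<le> 1" and V: "4 \<le> card V"
    and t: "12 * real t \<le> \<beta> * card V"
  shows "\<exists>P M. disjoint_pairs P \<and> finite P \<and> \<Union>P \<subseteq> \<Union>M \<and> matching H M \<and> hosts M P \<and> card M = t \<and>
    (\<Sum>u\<in>V. (1/2::real) ^ card (completed H P u)) \<le> card V * (1 - \<beta> / 8) ^ t"
  using t
proof (induction t)
  case 0
  have "disjoint_pairs {}" "matching H {}" "hosts {} {}"
    by (auto simp: disjoint_pairs_def matching_def hosts_def)
  then show ?case
    by (intro exI[of _ "{}"]) (simp add: completed_def)
next
  case (Suc t)
  then obtain P M where P: "disjoint_pairs P" "finite P" and sub: "\<Union>P \<subseteq> \<Union>M"
    and M: "matching H M" "hosts M P" "card M = t"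
    and bound: "(\<Sum>u\<in>V. (1/2::real) ^ card (completed H P u)) \<le> card V * (1 - \<beta> / 8) ^ t"
    by auto
  define R where "R = \<Union>M"
  have R: "R \<subseteq> V" "card R = 3 * t"
    using Union_matching card_Union_matching M by (auto simp: R_def)
  have R4: "4 * real (card R) \<le> \<beta> * card V" "card R < \<beta> * card V"
    using R(2) Suc.prems by auto
  let ?w = "\<lambda>u. (1/2::real) ^ card (completed H P u)"
  obtain a b where ab: "a \<in> V - R" "b \<in> V - R"
    and gain: "\<beta> / 4 * sum ?w V \<le> (\<Sum>u\<in>V. if {u, a, b} \<in> H then ?w u else 0)"
    using heavy_pair[OF codeg _ _ V R(1) R4(1), of ?w] \<beta> by auto
  have "V \<noteq> {}"
    using V by auto
  then have "0 < sum ?w V"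
    using finite_V by (intro sum_pos) auto
  \<comment> \<open>Strict positivity of the gain produces an edge through \<open>a\<close> and
    \<open>b\<close>, which shows that they differ.\<close>
  then have "0 < \<beta> / 4 * sum ?w V"
    using \<beta> by simp
  then have "(\<Sum>u\<in>V. if {u, a, b} \<in> H then ?w u else 0) \<noteq> 0"
    using gain by linarith
  then obtain u0 where "(if {u0, a, b} \<in> H then ?w u0 else 0) \<noteq> 0"
    by (rule sum.not_neutral_contains_not_neutral)
  then have "{u0, a, b} \<in> H"
    by (auto split: if_splits)
  then have "a \<noteq> b"
    using edge_distinct(4) by fastforce
  \<comment> \<open>The codegree exceeds the number of covered vertices, so some edge on
    \<open>a\<close>, \<open>b\<close> has its third vertex outside \<open>R\<close> and can host
    the new pair.\<close>
  then have "real (card R) < card {x. {a, b, x} \<in> H}"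
    using codeg[of a b] ab R4 by auto
  then have "\<not> {x. {a, b, x} \<in> H} \<subseteq> R"
    using card_mono[of R] R finite_V by (metis finite_subset linorder_not_less of_nat_le_iff)
  then obtain x where x: "{a, b, x} \<in> H" "x \<notin> R"
    by blast
  have dist: "distinct [a, b, x]"
    using edge_distinct(4)[OF x(1)] .
  let ?P = "insert {a, b} P" and ?M = "insert {a, b, x} M"
  have abP: "{a, b} \<notin> P"
    using ab sub by (auto simp: R_def)
  have "disjoint_pairs ?P"
    using P(1) sub ab dist unfolding disjoint_pairs_def R_def
    by (auto simp: pairwise_insert disjnt_iff)
  moreover have "\<Union>?P \<subseteq> \<Union>?M"
    using sub by auto
  moreover have "matching H ?M"
    using M(1) x ab unfolding matching_def R_def by (auto simp: pairwise_insert disjnt_iff)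
  moreover have "hosts ?M ?P"
  proof -
    have "{a, b, x} = insert x {a, b}" by blast
    then show ?thesis
      using M(2) dist unfolding hosts_def by (auto intro: exI[of _ x])
  qed
  moreover have "card ?M = Suc t"
  proof -
    have "{a, b, x} \<notin> M"
      using x(2) by (auto simp: R_def)
    then show ?thesis using M(3) finite_matching[OF M(1)] by simp
  qed
  moreover have "(\<Sum>u\<in>V. (1/2::real) ^ card (completed H ?P u)) \<le> card V * (1 - \<beta> / 8) ^ Suc t"
  proof -
    \<comment> \<open>Exactly the vertices completing the new pair have their weight halved, so a
      gain of \<open>\<beta> / 4\<close> lowers the total by a factor
      \<open>1 - \<beta> / 8\<close>.\<close>
    have "(1/2::real) ^ card (completed H ?P u) = ?w u - (if {u, a, b} \<in> H then ?w u else 0) / 2" for u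
    proof -
      have "completed H ?P u =
          (if {u, a, b} \<in> H then insert {a, b} (completed H P u) else completed H P u)"
        by (auto simp: completed_def)
      moreover have "finite (completed H P u)" "{a, b} \<notin> completed H P u"
        using P(2) abP by (auto simp: completed_def)
      ultimately show ?thesis by simp
    qed
    then have "(\<Sum>u\<in>V. (1/2::real) ^ card (completed H ?P u)) =
        sum ?w V - (\<Sum>u\<in>V. if {u, a, b} \<in> H then ?w u else 0) / 2"
      by (simp add: sum_subtractf sum_divide_distrib)
    also have "\<dots> \<le> sum ?w V * (1 - \<beta> / 8)"
      using gain by (simp add: algebra_simps)
    also have "\<dots> \<le> card V * (1 - \<beta> / 8) ^ t * (1 - \<beta> / 8)"
      using bound \<beta> by (intro mult_right_mono) auto
    finally show ?thesis by (simp add: mult_ac)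
  qed
  ultimately show ?case
    using P(2) by blast
qed

text \<open>A single weight is at most the total, so taking logarithms gives
  \<open>k * ln 2 \<ge> \<beta> * m / 8 - ln n\<close>. The first term is at least
  \<open>\<beta>\<^sup>2 * n / 192\<close>, and \<open>log\<close> lets \<open>ln n\<close> consume
  at most half of that.\<close>

lemma many_completed_pairs:
  fixes \<beta> :: real
  assumes codeg: "\<And>u v. u \<in> V \<Longrightarrow> v \<in> V \<Longrightarrow> u \<noteq> v \<Longrightarrow> \<beta> * card V \<le> card {b. {u, v, b} \<in> H}"
    and \<beta>: "0 < \<beta>" "\<beta> \<le> 1" and V: "4 \<le> card V" "12 \<le> \<beta> * card V"
    and log: "ln (card V) \<le> \<beta>\<^sup>2 * card V / 384"
  shows "\<exists>P M. disjoint_pairs P \<and> matching H M \<and> hosts M P \<and>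
    (\<forall>u\<in>V. \<beta>\<^sup>2 * card V / 384 \<le> card (completed H P u))"
proof -
  let ?n = "real (card V)"
  \<comment> \<open>Rounding down loses at most a factor 2, because \<open>\<beta> * n / 12\<close>
    is at least 1.\<close>
  define m where "m = nat \<lfloor>\<beta> * ?n / 12\<rfloor>"
  have m: "12 * real m \<le> \<beta> * ?n" "\<beta> * ?n / 24 \<le> m"
  proof -
    have "real m = of_int \<lfloor>\<beta> * ?n / 12\<rfloor>" "1 \<le> \<lfloor>\<beta> * ?n / 12\<rfloor>"
      using V \<beta> by (simp_all add: m_def le_floor_iff)
    then show "12 * real m \<le> \<beta> * ?n" "\<beta> * ?n / 24 \<le> m"
      by linarith+
  qed
  obtain P M where PM: "disjoint_pairs P" "matching H M" "hosts M P"
    and bound: "(\<Sum>u\<in>V. (1/2::real) ^ card (completed H P u)) \<le> ?n * (1 - \<beta> / 8) ^ m"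
    using greedy_pairs[OF codeg \<beta> V(1) m(1)] by blast
  have "\<beta>\<^sup>2 * ?n / 384 \<le> card (completed H P u)" if u: "u \<in> V" for u
  proof -
    let ?k = "card (completed H P u)"
    have "(1/2::real) ^ ?k \<le> (\<Sum>u\<in>V. (1/2::real) ^ card (completed H P u))"
      using u finite_V by (intro member_le_sum) auto
    also have "\<dots> \<le> ?n * exp (- \<beta> / 8) ^ m"
      using bound exp_ge_add_one_self[of "- \<beta> / 8"] \<beta>
      by (elim order_trans) (intro mult_left_mono power_mono, auto)
    finally have "ln ((1/2::real) ^ ?k) \<le> ln (?n * exp (- \<beta> / 8) ^ m)"
      using V by (subst ln_le_cancel_iff) auto
    then have "- (?k * ln 2) \<le> ln ?n - \<beta> / 8 * m"
      using V by (simp add: ln_mult ln_realpow ln_div mult_ac)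
    moreover have "\<beta> / 8 * (\<beta> * ?n / 24) \<le> \<beta> / 8 * m"
      using m \<beta> by (intro mult_left_mono) auto
    moreover have "?k * ln 2 \<le> ?k * (1::real)"
      using ln_2_less_1 by (intro mult_left_mono) auto
    ultimately show ?thesis
      using log by (simp add: power2_eq_square)
  qed
  then show ?thesis
    using PM by blast
qed

end

section \<open>The spectral bound for edge-free triples of sets\<close>

lemma sum_indicator_subset:
  assumes "finite A" "X \<subseteq> A"
  shows "sum (indicator X) A = real (card X)"
  using assms by (simp add: indicator_def sum.If_cases Int_absorb1)

lemma L2_set_normalized_indicator:
  assumes "finite A" "X \<subseteq> A" "X \<noteq> {}"
  shows "L2_set (\<lambda>i. indicator X i / sqrt (card X)) A = 1"
proof -
  have "(\<Sum>i\<in>A. (indicator X i / sqrt (card X))\<^sup>2) = (\<Sum>i\<in>A. indicator X i / real (card X))"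
    by (intro sum.cong) (auto simp: indicator_def power_divide)
  also have "\<dots> = card X / card X"
    using assms by (simp add: sum_divide_distrib[symmetric] sum_indicator_subset)
  also have "\<dots> = 1"
    using assms by (simp add: finite_subset)
  finally show ?thesis by (simp add: L2_set_def)
qed

text \<open>Test the norm on the normalized indicators of the three sets: the adjacency tensor
  vanishes on their product, which leaves only the term with \<open>J\<close>. The sets may
  overlap.\<close>

lemma edge_free_le_lambda2:
  assumes sub: "X \<subseteq> {1..n}" "Y \<subseteq> {1..n}" "Z \<subseteq> {1..n}" and ne: "X \<noteq> {}" "Y \<noteq> {}" "Z \<noteq> {}"
    and free: "\<And>x y z. x \<in> X \<Longrightarrow> y \<in> Y \<Longrightarrow> z \<in> Z \<Longrightarrow> {x, y, z} \<notin> H"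
  shows "edge_density n H * sqrt (real (card X) * real (card Y) * real (card Z)) \<le> lambda2 n H"
proof -
  define p where "p = edge_density n H"
  define T where "T = (\<lambda>i j k. adj_tensor H i j k - p * ones_tensor i j k)"
  define f :: "nat set \<Rightarrow> nat \<Rightarrow> real" where "f = (\<lambda>X i. indicator X i / sqrt (card X))"
  have sum_f: "(\<Sum>i\<in>{1..n}. f A i) = sqrt (card A)" if "A \<subseteq> {1..n}" "A \<noteq> {}" for A
  proof -
    have "(\<Sum>i\<in>{1..n}. f A i) = card A / sqrt (card A)"
      using that by (simp add: f_def sum_divide_distrib[symmetric] sum_indicator_subset)
    then show ?thesis by (simp add: real_div_sqrt)
  qed
  have "tensor_form n T (f X) (f Y) (f Z) =
      (\<Sum>i\<in>{1..n}. \<Sum>j\<in>{1..n}. \<Sum>k\<in>{1..n}. - p * (f X i * (f Y j * f Z k)))"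
    unfolding tensor_form_def
    by (intro sum.cong refl)
      (auto simp: T_def f_def adj_tensor_def ones_tensor_def indicator_def free)
  also have "\<dots> = - p * ((\<Sum>i\<in>{1..n}. f X i) * ((\<Sum>j\<in>{1..n}. f Y j) * (\<Sum>k\<in>{1..n}. f Z k)))"
    by (simp only: sum_distrib_left[symmetric] sum_distrib_right[symmetric])
  also have "\<dots> = - p * sqrt (real (card X) * real (card Y) * real (card Z))"
    using sum_f sub ne by (simp add: real_sqrt_mult)
  finally have form: "\<bar>tensor_form n T (f X) (f Y) (f Z)\<bar> =
      p * sqrt (real (card X) * real (card Y) * real (card Z))"
    by (simp add: abs_mult p_def edge_density_def)
  have "L2_set (f A) {1..n} = 1" if "A \<subseteq> {1..n}" "A \<noteq> {}" for A
    using L2_set_normalized_indicator[of "{1..n}" A] that by (simp add: f_def)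
  then have "\<bar>tensor_form n T (f X) (f Y) (f Z)\<bar> \<le> tensor_norm n T"
    unfolding tensor_norm_def using sub ne by (intro cSup_upper[OF _ tensor_norm_bdd_above]) blast
  then show ?thesis
    unfolding form by (simp add: lambda2_def T_def p_def)
qed

section \<open>Density and codegrees\<close>

lemma edge_density_le_1:
  assumes "three_graph n H"
  shows "edge_density n H \<le> 1"
proof -
  have "card H \<le> card {e. e \<subseteq> {1..n} \<and> card e = 3}"
    using assms by (intro card_mono) (auto simp: three_graph_def)
  also have "\<dots> = n choose 3"
    by (simp add: n_subsets)
  finally have "6 * card H \<le> fact 3 * (n choose 3)"
    by (simp add: fact_numeral)
  also have "\<dots> \<le> n ^ 3"
    by (metis binomial_fact_pow mult.commute)
  finally have "6 * real (card H) \<le> real n ^ 3"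
    by (metis of_nat_le_iff of_nat_mult of_nat_numeral of_nat_power)
  then show ?thesis
    by (auto simp: edge_density_def divide_le_eq_1)
qed

lemma three_uniform_three_graph: "three_graph n H \<Longrightarrow> three_uniform {1..n} H"
  by unfold_locales (auto simp: three_graph_def)

lemma pair_degree_le:
  assumes H: "three_graph n H" and uv: "u \<noteq> v"
  shows "pair_degree H u v \<le> card {b. {u, v, b} \<in> H}"
proof -
  have sub: "{e \<in> H. {u, v} \<subseteq> e} \<subseteq> (\<lambda>b. {u, v, b}) ` {b. {u, v, b} \<in> H}"
  proof
    fix e assume e: "e \<in> {e \<in> H. {u, v} \<subseteq> e}"
    then have "card (e - {u, v}) = 1"
      using H uv by (auto simp: three_graph_def card_Diff_subset)
    then obtain b where "e - {u, v} = {b}"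
      by (metis card_1_singletonE)
    then have "e = {u, v, b}"
      using e by blast
    then show "e \<in> (\<lambda>b. {u, v, b}) ` {b. {u, v, b} \<in> H}"
      using e by blast
  qed
  have fin: "finite {b. {u, v, b} \<in> H}"
  proof (rule finite_subset)
    show "{b. {u, v, b} \<in> H} \<subseteq> {1..n}"
      using three_uniform.edge_distinct(3)[OF three_uniform_three_graph[OF H]] by (intro subsetI) simp
  qed simp
  have "pair_degree H u v \<le> card ((\<lambda>b. {u, v, b}) ` {b. {u, v, b} \<in> H})"
    unfolding pair_degree_def by (rule card_mono[OF finite_imageI[OF fin] sub])
  also have "\<dots> \<le> card {b. {u, v, b} \<in> H}"
    using fin by (rule card_image_le)
  finally show ?thesis .
qed

section \<open>Choice of the constants and conclusion\<close>

text \<open>The hypothesis that \<open>H\<close> is nonempty makes the density positive. For empty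
  \<open>H\<close> and positive \<open>n\<close> the density and \<open>lambda2\<close> are 0, so
  the codegree and spectral conditions hold although there is no perfect matching.\<close>

theorem theorem1p7:
  fixes \<alpha> :: real
  assumes "\<alpha> > 0"
  shows "\<exists>(n0::nat) (\<gamma>::real). \<gamma> > 0 \<and>
    (\<forall>n H. three_graph n H \<longrightarrow> H \<noteq> {} \<longrightarrow> 3 dvd n \<longrightarrow> n \<ge> n0 \<longrightarrow>
      (\<forall>u\<in>{1..n}. \<forall>v\<in>{1..n}. u \<noteq> v \<longrightarrow>
         real (pair_degree H u v) \<ge> \<alpha> * edge_density n H * real n) \<longrightarrow>
      lambda2 n H \<le> \<gamma> * edge_density n H ^ 16 * real n powr (3 / 2) \<longrightarrow>
      has_perfect_matching n H)"
proof -
  \<comment> \<open>Both conditions involve \<open>sqrt n\<close> because \<open>pn\<close> below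
    gives \<open>p\<^sup>2 * n \<ge> sqrt n\<close>; they turn into the size and \<open>log\<close>
    conditions of \<open>many_completed_pairs\<close>.\<close>
  have "eventually (\<lambda>n::nat. ln (real n) \<le> \<alpha>\<^sup>2 * sqrt (real n) / 384) sequentially"
    using assms by real_asymp
  moreover have "eventually (\<lambda>n::nat. 12 \<le> \<alpha> * sqrt (real n)) sequentially"
    using assms by real_asymp
  ultimately have "eventually (\<lambda>n::nat. ln (real n) \<le> \<alpha>\<^sup>2 * sqrt (real n) / 384 \<and>
      12 \<le> \<alpha> * sqrt (real n)) sequentially"
    by (rule eventually_conj)
  then obtain n1 where n1: "\<And>n. n \<ge> n1 \<Longrightarrow>
      ln (real n) \<le> \<alpha>\<^sup>2 * sqrt (real n) / 384 \<and> 12 \<le> \<alpha> * sqrt (real n)"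
    unfolding eventually_sequentially by blast
  \<comment> \<open>The bound 1 serves the lower bound on \<open>p\<close>. The other bound serves
    \<open>mix\<close>, where \<open>10000 ^ 2 > 384 ^ 3\<close> yields the contradiction.\<close>
  define \<gamma> where "\<gamma> = min 1 (\<alpha> ^ 3 / 10000)"
  have \<gamma>: "0 < \<gamma>" "\<gamma> \<le> 1" "\<gamma> \<le> \<alpha> ^ 3 / 10000"
    using assms by (auto simp: \<gamma>_def)
  show ?thesis
  proof (intro exI[of _ "max 4 n1"] exI[of _ \<gamma>] conjI allI impI)
    fix n H
    assume H: "three_graph n H" "H \<noteq> {}" and dvd: "3 dvd n" and n: "max 4 n1 \<le> n"
      and codeg: "\<forall>u\<in>{1..n}. \<forall>v\<in>{1..n}. u \<noteq> v \<longrightarrow>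
         real (pair_degree H u v) \<ge> \<alpha> * edge_density n H * real n"
      and lam: "lambda2 n H \<le> \<gamma> * edge_density n H ^ 16 * real n powr (3 / 2)"
    interpret three_uniform "{1..n}" H
      using H(1) by (rule three_uniform_three_graph)
    define p where "p = edge_density n H"
    have p1: "p \<le> 1"
      using edge_density_le_1[OF H(1)] by (simp add: p_def)
    have p0: "0 < p"
      using H(2) n finite_H by (simp add: p_def edge_density_def card_gt_0_iff)
    have n4: "real n \<ge> 4"
      using n by simp
    have powr: "real n powr (3 / 2) = sqrt (real n) * real n"
      using n4 by (simp add: powr_half_sqrt[symmetric] powr_mult_base mult.commute)
    have sqrt_n: "sqrt (real n) * sqrt (real n) = real n"
      by simp
    \<comment> \<open>Degenerate triples \<open>(1, 1, k)\<close> are never edges, so \<open>\<lambda>\<^sub>2\<close> is at least \<open>p \<surd>n\<close>;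
      this forces \<open>p\<close> to be large.\<close>
    have "p * sqrt n \<le> lambda2 n H"
      using edge_free_le_lambda2[of "{1}" n "{1}" "{1..n}" H] edge_distinct(4)[of 1 1] n
      by (auto simp: p_def)
    also have "\<dots> \<le> \<gamma> * p ^ 16 * (sqrt n * n)"
      using lam by (simp add: p_def powr)
    also have "\<dots> \<le> 1 * p ^ 16 * (sqrt n * n)"
      using \<gamma> p0 by (intro mult_right_mono) auto
    also have "\<dots> = p * sqrt n * (p ^ 15 * n)"
      by (simp add: power_numeral_reduce)
    finally have "1 \<le> p ^ 15 * n"
      using p0 n4 by simp
    also have "\<dots> \<le> p ^ 4 * n"
      using p0 p1 by (intro mult_right_mono power_decreasing) auto
    finally have "real n * 1 \<le> n * (p ^ 4 * n)"
      by (intro mult_left_mono) auto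
    then have "real n \<le> (p\<^sup>2 * n)\<^sup>2"
      by (simp add: power2_eq_square power_numeral_reduce mult_ac)
    then have pn: "sqrt n \<le> p\<^sup>2 * n"
      by (simp add: real_le_lsqrt)
    define \<beta> where "\<beta> = \<alpha> * p"
    have codeg': "\<beta> * card {1..n} \<le> card {b. {u, v, b} \<in> H}"
      if "u \<in> {1..n}" "v \<in> {1..n}" "u \<noteq> v" for u v
    proof -
      have "\<beta> * n \<le> pair_degree H u v"
        using codeg that by (simp add: \<beta>_def p_def)
      then show ?thesis
        using pair_degree_le[OF H(1) that(3)] by (simp add: order_trans)
    qed
    have \<beta>0: "0 < \<beta>"
      using assms p0 by (simp add: \<beta>_def)
    \<comment> \<open>The codegree of the vertices 1 and 2 is at most \<open>n\<close>.\<close>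
    have \<beta>1: "\<beta> \<le> 1"
    proof -
      have "\<beta> * n \<le> card {b. {1, 2, b} \<in> H}"
        using codeg'[of 1 2] n by simp
      also have "\<dots> \<le> card {1..n}"
        using edge_distinct(3) by (intro of_nat_mono card_mono) auto
      finally show ?thesis using n4 by simp
    qed
    have V: "12 \<le> \<beta> * card {1..n}"
    proof -
      have "p\<^sup>2 * n \<le> p * n"
        using p0 p1 by (intro mult_right_mono) (auto simp: power2_eq_square mult_left_le)
      then have "\<alpha> * sqrt n \<le> \<alpha> * (p * n)"
        using pn assms by (intro mult_left_mono) auto
      then show ?thesis
        using n1[of n] n by (simp add: \<beta>_def mult.assoc)
    qed
    have log: "ln (card {1..n}) \<le> \<beta>\<^sup>2 * card {1..n} / 384"
    proof -
      have "\<alpha>\<^sup>2 * sqrt n \<le> \<alpha>\<^sup>2 * (p\<^sup>2 * n)"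
        using pn by (intro mult_left_mono) auto
      then show ?thesis
        using n1[of n] n by (simp add: \<beta>_def power_mult_distrib mult.assoc)
    qed
    define D where "D = \<beta>\<^sup>2 * n / 384"
    have D0: "0 < D"
      using \<beta>0 n4 by (simp add: D_def)
    \<comment> \<open>Translates the real threshold \<open>D\<close> into the natural number
      \<open>d\<close> of \<open>perfect_matching_of_pairs\<close>.\<close>
    have card_ge: "nat \<lceil>D\<rceil> \<le> k \<longleftrightarrow> D \<le> real k" for k
      by (simp add: nat_le_iff ceiling_le_iff)
    obtain P M where P: "disjoint_pairs P" "matching H M" "hosts M P"
      and many: "\<And>u. u \<in> {1..n} \<Longrightarrow> nat \<lceil>D\<rceil> \<le> card (completed H P u)"
      using many_completed_pairs[OF codeg' \<beta>0 \<beta>1 _ V log] n by (auto simp: card_ge D_def)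
    \<comment> \<open>An edge-free triple would give
      \<open>p * sqrt (D ^ 3) \<le> lambda2 n H\<close>. The left side is
      \<open>\<alpha> ^ 3 * p ^ 4 * n powr (3 / 2)\<close> divided by
      \<open>384 powr (3 / 2)\<close>, so the right side is brought to the power
      \<open>p ^ 4\<close> as well.\<close>
    have mix: "\<exists>x\<in>X. \<exists>y\<in>Y. \<exists>z\<in>Z. {x, y, z} \<in> H"
      if sub: "X \<subseteq> {1..n}" "Y \<subseteq> {1..n}" "Z \<subseteq> {1..n}"
        and large: "nat \<lceil>D\<rceil> \<le> card X" "nat \<lceil>D\<rceil> \<le> card Y" "nat \<lceil>D\<rceil> \<le> card Z" for X Y Z
    proof (rule ccontr)
      assume free: "\<not> ?thesis"
      have ge: "D \<le> card X" "D \<le> card Y" "D \<le> card Z"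
        using large by (simp_all only: card_ge)
      then have "X \<noteq> {}" "Y \<noteq> {}" "Z \<noteq> {}"
        using D0 by auto
      then have le: "p * sqrt (real (card X) * real (card Y) * real (card Z)) \<le> lambda2 n H"
        using edge_free_le_lambda2[OF sub] free by (auto simp: p_def)
      have "D * D * D \<le> real (card X) * real (card Y) * real (card Z)"
        using ge D0 by (intro mult_mono) auto
      then have "p * sqrt (D ^ 3) \<le> p * sqrt (real (card X) * real (card Y) * real (card Z))"
        using p0 by (simp add: power3_eq_cube)
      also note le
      also have "lambda2 n H \<le> \<alpha> ^ 3 / 10000 * p ^ 16 * (sqrt n * n)"
      proof -
        have "\<gamma> * (p ^ 16 * (sqrt n * n)) \<le> \<alpha> ^ 3 / 10000 * (p ^ 16 * (sqrt n * n))"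
          using \<gamma>(3) p0 by (intro mult_right_mono) auto
        then show ?thesis
          using lam unfolding p_def powr mult.assoc by linarith
      qed
      also have "\<dots> \<le> \<alpha> ^ 3 / 10000 * p ^ 4 * (sqrt n * n)"
        using p0 p1 assms by (intro mult_right_mono mult_left_mono power_decreasing) auto
      \<comment> \<open>Squaring removes the half-integral powers, so that only the constants remain
        to be compared.\<close>
      finally have "(p * sqrt (D ^ 3))\<^sup>2 \<le> (\<alpha> ^ 3 / 10000 * p ^ 4 * (sqrt n * n))\<^sup>2"
        using p0 D0 by (intro power_mono) auto
      moreover have "(p * sqrt (D ^ 3))\<^sup>2 = \<alpha> ^ 6 * p ^ 8 * n ^ 3 / 384 ^ 3"
      proof -
        have "(p * sqrt (D ^ 3))\<^sup>2 = p\<^sup>2 * D ^ 3"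
          using D0 by (simp add: power_mult_distrib)
        also have "\<dots> = \<alpha> ^ 6 * p ^ 8 * n ^ 3 / 384 ^ 3"
          by (simp add: power_mult_distrib D_def \<beta>_def power_divide flip: power_mult power_add)
        finally show ?thesis .
      qed
      moreover have "(\<alpha> ^ 3 / 10000 * p ^ 4 * (sqrt n * n))\<^sup>2 = \<alpha> ^ 6 * p ^ 8 * n ^ 3 / 10000 ^ 2"
        by (simp add: power_mult_distrib power_divide power_numeral_reduce)
      ultimately have "\<alpha> ^ 6 * p ^ 8 * n ^ 3 / 384 ^ 3 \<le> \<alpha> ^ 6 * p ^ 8 * n ^ 3 / 10000 ^ 2"
        by (simp only:)
      moreover have "0 < \<alpha> ^ 6 * p ^ 8 * n ^ 3"
        using assms p0 n4 by simp
      ultimately show False by (simp add: mult_ac)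
    qed
    show "has_perfect_matching n H"
      using perfect_matching_of_pairs[OF P many mix] dvd
      by (auto simp: has_perfect_matching_def matching_def)
  qed (rule \<gamma>)
qed

end
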